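(* If $a>0$, then each of the sets $\{0\}$, $\{0,a\}$, $[0,a]$, and $[0,\infty)$ is the fixed point set of some metric transform. Conversely, if $f:[0,\infty)\to[0,\infty)$ is a metric transform, then $\operatorname{Fix} f$ is equal to $\{0\}$, $\{0,a\}$, $[0,a]$, or $[0,\infty)$ for some $a\in(0,\infty)$.
   Context: A function $f:[0,\infty)\to[0,\infty)$ is a metric transform if $f(0)=0$, $f$ is strictly increasing on $[0,\infty)$, and $f$ is concave on $[0,\infty)$. $\operatorname{Fix} f=\{x\in[0,\infty): f(x)=x\}$ is the fixed point set of $f$. *)

theory Defs
  imports "HOL-Analysis.Analysis"
begin

text \<open>A map from \<open>[0,\<infinity>)\<close> to itself is represented by a function on all reals, of which only
  the restriction to \<open>{0..}\<close> matters.\<close>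

definition metric_transform :: "(real \<Rightarrow> real) \<Rightarrow> bool" where
  "metric_transform f \<longleftrightarrow>
     f \<in> {0..} \<rightarrow> {0..} \<and> f 0 = 0 \<and> strict_mono_on {0..} f \<and> concave_on {0..} f"

definition Fix :: "(real \<Rightarrow> real) \<Rightarrow> real set" where
  "Fix f = {x \<in> {0..}. f x = x}"

end

theory Submission
  imports Defs
begin

text \<open>A concave \<open>f\<close> with \<open>f 0 = 0\<close> satisfies \<open>f x \<ge> x\<close> to the left of a positive fixed point and
  \<open>f x \<le> x\<close> to the right of it. Given two positive fixed points \<open>u < v\<close>, concavity across \<open>u\<close>
  therefore makes \<open>f\<close> the identity on \<open>[0, v]\<close>. So with at least two positive fixed points the
  fixed point set is an initial segment of \<open>[0, \<infinity>)\<close>; if it is bounded, monotonicity shows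
  that it contains its supremum. The examples are minima of two increasing linear or affine functions.\<close>

text \<open>The chord inequality with denominators cleared: the degenerate case \<open>x = z\<close>
  needs no exclusion, and taking 0 as an endpoint leaves a plain product inequality.\<close>

lemma concave_on_three_points:
  fixes f :: "real \<Rightarrow> real"
  assumes "concave_on S f" "x \<in> S" "z \<in> S" "x \<le> y" "y \<le> z"
  shows "(z - y) * f x + (y - x) * f z \<le> (z - x) * f y"
proof (cases "x = z")
  case False
  then have xz: "x < z" using assms by simp
  define t where "t = (y - x) / (z - x)"
  have t: "0 \<le> t" "t \<le> 1" using assms xz by (auto simp: t_def)
  have tz: "(z - x) * t = y - x" using xz by (simp add: t_def)
  then have y: "y = (1 - t) * x + t * z" by algebra
  have "(1 - t) * f x + t * f z \<le> f y"
    using concave_onD[OF assms(1) t assms(2,3)] y by simp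
  then have "(z - x) * ((1 - t) * f x + t * f z) \<le> (z - x) * f y"
    using xz by (intro mult_left_mono) auto
  moreover have "(z - x) * ((1 - t) * f x + t * f z) = (z - y) * f x + (y - x) * f z"
    using tz by algebra
  ultimately show ?thesis by simp
qed (use assms in auto)

lemma concave_on_min:
  fixes f g :: "'a::real_vector \<Rightarrow> real"
  assumes "concave_on S f" "concave_on S g"
  shows "concave_on S (\<lambda>x. min (f x) (g x))"
proof (unfold concave_on_iff, intro conjI ballI allI impI)
  show "convex S" using assms(1) by (simp add: concave_on_iff)
  fix x y u v assume xy: "x \<in> S" "y \<in> S" and uv: "0 \<le> u" "0 \<le> v" "u + v = (1::real)"
  have "u * f x + v * f y \<le> f (u *\<^sub>R x + v *\<^sub>R y)" "u * g x + v * g y \<le> g (u *\<^sub>R x + v *\<^sub>R y)"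
    using assms xy uv by (auto simp: concave_on_iff)
  moreover have "u * min (f x) (g x) \<le> u * f x" "u * min (f x) (g x) \<le> u * g x"
    "v * min (f y) (g y) \<le> v * f y" "v * min (f y) (g y) \<le> v * g y"
    using uv by (auto intro: mult_left_mono)
  ultimately show "u * min (f x) (g x) + v * min (f y) (g y)
      \<le> min (f (u *\<^sub>R x + v *\<^sub>R y)) (g (u *\<^sub>R x + v *\<^sub>R y))"
    by linarith
qed

lemma concave_on_affine:
  fixes c d :: real
  assumes "convex S"
  shows "concave_on S (\<lambda>x. c * x + d)"
  unfolding concave_on_iff
proof (intro conjI ballI allI impI)
  fix x y u v :: real assume "u + v = 1"
  then have "u * (c * x + d) + v * (c * y + d) = c * (u * x + v * y) + d" by algebra
  then show "u * (c * x + d) + v * (c * y + d) \<le> c * (u *\<^sub>R x + v *\<^sub>R y) + d" by simp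
qed (rule assms)

lemma metric_transform_linear:
  assumes "c > 0"
  shows "metric_transform (\<lambda>x. c * x)"
  unfolding metric_transform_def
  using assms concave_on_affine[of "{0..}" c 0] by (auto simp: strict_mono_on_def)

lemma metric_transform_min_affine:
  assumes "c > 0" "d > 0" "e \<ge> 0"
  shows "metric_transform (\<lambda>x. min (c * x) (d * x + e))"
proof -
  have "concave_on {0..} (\<lambda>x. min (c * x) (d * x + e))"
    using concave_on_min[OF concave_on_affine[of "{0..}" c 0] concave_on_affine[of "{0..}" d e]]
    by simp
  moreover have "strict_mono_on {0..} (\<lambda>x. min (c * x) (d * x + e))"
  proof (rule strict_mono_onI)
    fix x y :: real assume "x < y"
    then have "c * x < c * y" "d * x < d * y" using assms by auto
    then show "min (c * x) (d * x + e) < min (c * y) (d * y + e)" by linarith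
  qed
  ultimately show ?thesis using assms by (auto simp: metric_transform_def)
qed

lemma Fix_realizable:
  assumes "a > 0" "S \<in> {{0}, {0, a}, {0..a}, {0..}}"
  shows "\<exists>f. metric_transform f \<and> Fix f = S"
proof -
  have "Fix (\<lambda>x. (1/2) * x) = {0}" "Fix (\<lambda>x. 1 * x) = {0..}"
    by (auto simp: Fix_def)
  \<comment> \<open>The line of slope 1/2 crosses the diagonal exactly at \<open>a\<close>, from
    above to below. Slope 2 keeps the other piece strictly above the diagonal on (0, a); slope 1, in
    the next example, puts it on the diagonal.\<close>
  moreover have "Fix (\<lambda>x. min (2 * x) ((1/2) * x + a/2)) = {0, a}"
    using assms(1) by (auto simp: Fix_def min_def split: if_splits)
  moreover have "Fix (\<lambda>x. min (1 * x) ((1/2) * x + a/2)) = {0..a}"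
    using assms(1) by (auto simp: Fix_def min_def split: if_splits)
  ultimately show ?thesis
    using assms metric_transform_linear[of "1/2"] metric_transform_linear[of 1]
      metric_transform_min_affine[of 2 "1/2" "a/2"] metric_transform_min_affine[of 1 "1/2" "a/2"]
    by (elim insertE emptyE; simp; blast)
qed

text \<open>As \<open>f 0 = 0\<close>, concavity makes the chord slope \<open>f x / x\<close>
  nonincreasing for x > 0, and this slope is 1 at \<open>u\<close>.\<close>

lemma metric_transform_le_right_of_fixpoint:
  assumes "metric_transform f" "f u = u" "0 < u" "u \<le> x"
  shows "f x \<le> x"
proof -
  have "u * f x \<le> u * x"
    using assms concave_on_three_points[of "{0..}" f 0 x u]
    by (simp add: metric_transform_def mult.commute)
  then show ?thesis using assms by simp
qed

text \<open>The chord from the origin to \<open>(v, v)\<close> lies on the diagonal, and a concave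
  graph lies above its chords.\<close>

lemma metric_transform_ge_left_of_fixpoint:
  assumes "metric_transform f" "f v = v" "0 < v" "0 \<le> x" "x \<le> v"
  shows "x \<le> f x"
proof -
  have "v * x \<le> v * f x"
    using assms concave_on_three_points[of "{0..}" f 0 v x]
    by (simp add: metric_transform_def mult.commute)
  then show ?thesis using assms by simp
qed

lemma metric_transform_id_below_two_fixpoints:
  assumes f: "metric_transform f" and u: "f u = u" "0 < u" and v: "f v = v" "u < v"
    and x: "0 \<le> x" "x \<le> v"
  shows "f x = x"
proof -
  have "f x \<le> x"
  proof (cases "u \<le> x")
    case True
    then show ?thesis using metric_transform_le_right_of_fixpoint[OF f u] by simp
  next
    case False
    \<comment> \<open>If \<open>f x > x\<close>, the chord from \<open>(x, f x)\<close> to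
      \<open>(v, v)\<close> would pass above the diagonal at \<open>u\<close>, contradicting
      \<open>f u = u\<close>.\<close>
    have "(v - u) * f x + (u - x) * v \<le> (v - x) * u"
      using f u v x False concave_on_three_points[of "{0..}" f x v u]
      by (simp add: metric_transform_def)
    then have "(v - u) * f x \<le> (v - u) * x" by (simp add: algebra_simps)
    then show ?thesis using v by simp
  qed
  then show ?thesis
    using metric_transform_ge_left_of_fixpoint[OF f v(1) _ x] u v by simp
qed

lemma Fix_of_two_positive_fixpoints:
  assumes f: "metric_transform f" and u: "f u = u" "0 < u" and v: "f v = v" "u < v"
  shows "\<exists>a>0. Fix f \<in> {{0..a}, {0..}}"
proof -
  \<comment> \<open>The bound \<open>v \<le> w\<close> gives \<open>u < w\<close>, so
    \<open>u\<close> and \<open>w\<close> are again two positive fixed points.\<close>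
  have down: "f x = x" if "w \<in> Fix f" "v \<le> w" "0 \<le> x" "x \<le> w" for w x
    using that metric_transform_id_below_two_fixpoints[OF f u, of w x] v by (auto simp: Fix_def)
  have vF: "v \<in> Fix f" using u v by (simp add: Fix_def)
  show ?thesis
  proof (cases "bdd_above (Fix f)")
    case True
    define a where "a = Sup (Fix f)"
    have le: "x \<le> a" if "x \<in> Fix f" for x
      using True that by (simp add: a_def cSup_upper)
    have va: "v \<le> a" using le vF .
    have below: "f x = x" if x: "0 \<le> x" "x < a" for x
    \<comment> \<open>The fixed point that the supremum provides beyond \<open>x\<close> might lie
      below \<open>v\<close>, where \<open>down\<close> does not apply; for \<open>x \<le> v\<close>
      the point \<open>v\<close> itself serves.\<close>
    proof (cases "x \<le> v")
      case True
      then show ?thesis using down vF x by blast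
    next
      case False
      obtain w where "w \<in> Fix f" "x < w"
        using less_cSupE[of x "Fix f"] x(2) vF by (auto simp: a_def)
      then show ?thesis using down[of w x] x False by simp
    qed
    \<comment> \<open>The supremum is attained: \<open>x = f x < f a\<close> for all x in (0, a), so
      \<open>f a\<close> bounds every number below \<open>a\<close>.\<close>
    have "a \<le> f a"
    proof (rule dense_le_bounded)
      show "0 < a" using u v va by simp
      fix x assume x: "0 < x" "x < a"
      then have "f x < f a"
        using f by (auto simp: metric_transform_def intro: strict_mono_onD)
      then show "x \<le> f a" using below[of x] x by simp
    qed
    then have "f a = a"
      using metric_transform_le_right_of_fixpoint[OF f u, of a] v va by simp
    then have "Fix f = {0..a}"
      using below le by (force simp: Fix_def)
    moreover have "a > 0" using u v va by simp
    ultimately show ?thesis by blast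
  next
    case False
    have "f x = x" if "0 \<le> x" for x
    proof -
      obtain w where "w \<in> Fix f" "max v x < w"
        using False by (meson bdd_aboveI linorder_not_le)
      then show ?thesis using down[of w x] that by simp
    qed
    then have "Fix f = {0..}" by (auto simp: Fix_def)
    \<comment> \<open>The set \<open>{0..}\<close> does not involve \<open>a\<close>, so any
      positive witness serves.\<close>
    then show ?thesis by (auto intro: exI[of _ 1])
  qed
qed

theorem theorem36:
  "(\<forall>a::real. a > 0 \<longrightarrow>
      (\<forall>S \<in> {{0}, {0, a}, {0..a}, {0..}}. \<exists>f. metric_transform f \<and> Fix f = S)) \<and>
   (\<forall>f. metric_transform f \<longrightarrow>
      (\<exists>a::real. a > 0 \<and> Fix f \<in> {{0}, {0, a}, {0..a}, {0..}}))"
proof (intro conjI allI impI ballI)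
  fix a :: real and S assume "a > 0" "S \<in> {{0}, {0, a}, {0..a}, {0..}}"
  then show "\<exists>f. metric_transform f \<and> Fix f = S" by (rule Fix_realizable)
next
  fix f assume f: "metric_transform f"
  have zero: "0 \<in> Fix f" using f by (simp add: Fix_def metric_transform_def)
  have nonneg: "Fix f \<subseteq> {0..}" by (auto simp: Fix_def)
  show "\<exists>a::real. a > 0 \<and> Fix f \<in> {{0}, {0, a}, {0..a}, {0..}}"
  \<comment> \<open>The cases are at least two, exactly one, or no positive fixed points.\<close>
  proof (cases "\<exists>u v. u \<in> Fix f \<and> v \<in> Fix f \<and> 0 < u \<and> u < v")
    case True
    then obtain u v where "f u = u" "0 < u" "f v = v" "u < v" by (auto simp: Fix_def)
    then show ?thesis using Fix_of_two_positive_fixpoints[OF f] by blast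
  next
    case False
    show ?thesis
    proof (cases "\<exists>a \<in> Fix f. a > 0")
      case True
      then obtain a where a: "a \<in> Fix f" "a > 0" by blast
      have "Fix f = {0, a}"
      proof
        show "Fix f \<subseteq> {0, a}"
        proof
          fix x assume x: "x \<in> Fix f"
          then have "0 \<le> x" using nonneg by auto
          \<comment> \<open>A positive fixed point other than \<open>a\<close>, on either side of
            it, would form with \<open>a\<close> a pair excluded by the outer case.\<close>
          then show "x \<in> {0, a}" using x a False by (metis insert_iff linorder_neqE order_le_less)
        qed
      qed (use a zero in auto)
      then show ?thesis using a by blast
    next
      case False
      then have "Fix f = {0}" using zero nonneg by force
      then show ?thesis by (auto intro: exI[of _ 1])
    qed
  qed
qed

end
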